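(* (1) If the disjointness matrix $R_d=\begin{bmatrix}1&1\\1&0\end{bmatrix}^{\otimes d}$, of side-length $N=2^d$, does not have (as $d\to\infty$) depth-2 linear circuits over $\mathbb{R}$ of size $N^{1+o(1)}$, then the Boolean Inner Product function on $n$-bit vectors does not have (as $n\to\infty$) $\mathsf{SUM}\circ\mathsf{ETHR}$ circuits of size $2^{o(n)}$. (2) If the Walsh--Hadamard matrix $H_d=\begin{bmatrix}1&1\\1&-1\end{bmatrix}^{\otimes d}$, of side-length $N=2^d$, does not have (as $d\to\infty$) depth-2 linear circuits over $\mathbb{R}$ of size $N^{1+o(1)}$, then the Boolean Inner Product Mod 2 function on $n$-bit vectors does not have (as $n\to\infty$) $\mathsf{SUM}\circ\mathsf{ETHR}$ circuits of size $2^{o(n)}$.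
   Context: $A^{\otimes d}$ is the $d$-fold Kronecker power; $\operatorname{nnz}$ counts nonzero entries. A depth-2 linear circuit over $\mathbb{R}$ computing $M$ is a factorization $M=UV^{\mathsf T}$ over $\mathbb{R}$; its size is $\operatorname{nnz}(U)+\operatorname{nnz}(V)$. Boolean Inner Product is the function $\{0,1\}^n\times\{0,1\}^n\to\{0,1\}$, $(x,y)\mapsto\bigvee_{i=1}^n(x_i\wedge y_i)$. Boolean Inner Product Mod 2 is $(x,y)\mapsto\sum_{i=1}^n x_iy_i \bmod 2$. An exact threshold ($\mathsf{ETHR}$) gate on Boolean inputs $z_1,\dots,z_\ell$ outputs $1$ if $\sum_i w_iz_i=t$ for prescribed $w_i,t\in\mathbb{R}$, and $0$ otherwise. A $\mathsf{SUM}\circ\mathsf{ETHR}$ circuit has a bottom layer of $\mathsf{ETHR}$ gates reading the inputs and a top gate that outputs a fixed real linear combination of the values of the bottom gates; it computes a Boolean function $g$ if its output equals $g$ on every input. Its size is the number of gates. *)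

theory Defs
  imports "Jordan_Normal_Form.Matrix" "HOL-Library.Landau_Symbols"
begin

definition kronecker :: "'a :: semiring_1 mat \<Rightarrow> 'a mat \<Rightarrow> 'a mat" where
  "kronecker A B = mat (dim_row A * dim_row B) (dim_col A * dim_col B)
     (\<lambda>(i, j). A $$ (i div dim_row B, j div dim_col B) * B $$ (i mod dim_row B, j mod dim_col B))"

primrec kronecker_power :: "'a :: semiring_1 mat \<Rightarrow> nat \<Rightarrow> 'a mat" where
  "kronecker_power A 0 = 1\<^sub>m 1"
| "kronecker_power A (Suc d) = kronecker A (kronecker_power A d)"

lemma dim_kronecker_power [simp]:
  "dim_row (kronecker_power A d) = dim_row A ^ d"
  "dim_col (kronecker_power A d) = dim_col A ^ d"
  by (induction d) (simp_all add: kronecker_def)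

definition disjointness_matrix :: "nat \<Rightarrow> real mat" where
  "disjointness_matrix d = kronecker_power (mat_of_rows_list 2 [[1, 1], [1, 0]]) d"

definition walsh_hadamard_matrix :: "nat \<Rightarrow> real mat" where
  "walsh_hadamard_matrix d = kronecker_power (mat_of_rows_list 2 [[1, 1], [1, -1]]) d"

definition nnz :: "'a :: zero mat \<Rightarrow> nat" where
  "nnz A = card {(i, j). i < dim_row A \<and> j < dim_col A \<and> A $$ (i, j) \<noteq> 0}"

definition depth2_linear_circuit :: "real mat \<Rightarrow> real mat \<Rightarrow> real mat \<Rightarrow> bool" where
  "depth2_linear_circuit M U V \<longleftrightarrow>
     (\<exists>k. U \<in> carrier_mat (dim_row M) k \<and> V \<in> carrier_mat (dim_col M) k) \<and>
     M = U * transpose_mat V"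

definition depth2_linear_circuit_size :: "real mat \<Rightarrow> real mat \<Rightarrow> nat" where
  "depth2_linear_circuit_size U V = nnz U + nnz V"

text \<open>
  The family \<open>M\<^sub>d\<close>, of side-length \<open>N = 2\<^sup>d\<close>, has circuits of size \<open>N\<^bsup>1 + o(1)\<^esup>\<close> as \<open>d \<rightarrow> \<infinity>\<close>.
  The bound is only required for all large \<open>d\<close>: at \<open>d = 0\<close> we have \<open>N = 1\<close>, so that no power of
  \<open>N\<close> exceeds \<open>1\<close>, while a factorization of a nonzero matrix has size at least \<open>2\<close>.
\<close>
definition has_almost_linear_size_depth2_circuits :: "(nat \<Rightarrow> real mat) \<Rightarrow> bool" where
  "has_almost_linear_size_depth2_circuits M \<longleftrightarrow>
     (\<exists>e :: nat \<Rightarrow> real. e \<in> o(\<lambda>_. 1) \<and>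
       (\<forall>\<^sub>F d in sequentially. \<exists>U V. depth2_linear_circuit (M d) U V \<and>
          real (depth2_linear_circuit_size U V) \<le> (2 ^ d) powr (1 + e d)))"

datatype ethr_gate = ETHR (weights: "real list") (threshold: real)

definition ethr_eval :: "ethr_gate \<Rightarrow> bool list \<Rightarrow> real" where
  "ethr_eval G z =
     (if (\<Sum>i<length z. weights G ! i * of_bool (z ! i)) = threshold G then 1 else 0)"

text \<open>
  A circuit is the list of its bottom gates, each paired with the coefficient it has in the
  linear combination output by the top gate.
\<close>
type_synonym sum_ethr_circuit = "(real \<times> ethr_gate) list"

definition sum_ethr_wf :: "nat \<Rightarrow> sum_ethr_circuit \<Rightarrow> bool" where
  "sum_ethr_wf l C \<longleftrightarrow> (\<forall>(c, G) \<in> set C. length (weights G) = l)"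

definition sum_ethr_eval :: "sum_ethr_circuit \<Rightarrow> bool list \<Rightarrow> real" where
  "sum_ethr_eval C z = (\<Sum>(c, G) \<leftarrow> C. c * ethr_eval G z)"

text \<open>All gates are counted, including the top gate.\<close>
definition sum_ethr_size :: "sum_ethr_circuit \<Rightarrow> nat" where
  "sum_ethr_size C = length C + 1"

text \<open>The two \<open>n\<close>-bit arguments of \<open>g\<close> are the \<open>2 n\<close> inputs \<open>x @ y\<close> of the circuit.\<close>
definition sum_ethr_computes ::
    "nat \<Rightarrow> sum_ethr_circuit \<Rightarrow> (bool list \<Rightarrow> bool list \<Rightarrow> bool) \<Rightarrow> bool" where
  "sum_ethr_computes n C g \<longleftrightarrow> sum_ethr_wf (2 * n) C \<and>
     (\<forall>x y. length x = n \<longrightarrow> length y = n \<longrightarrow> sum_ethr_eval C (x @ y) = of_bool (g x y))"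

definition boolean_inner_product :: "nat \<Rightarrow> bool list \<Rightarrow> bool list \<Rightarrow> bool" where
  "boolean_inner_product n x y \<longleftrightarrow> (\<exists>i<n. x ! i \<and> y ! i)"

definition boolean_inner_product_mod2 :: "nat \<Rightarrow> bool list \<Rightarrow> bool list \<Rightarrow> bool" where
  "boolean_inner_product_mod2 n x y \<longleftrightarrow>
     (\<Sum>i<n. of_bool (x ! i) * of_bool (y ! i)) mod 2 = (1 :: nat)"

text \<open>The family \<open>g\<^sub>n\<close> of functions on \<open>n\<close>-bit vectors has circuits of size \<open>2\<^bsup>o(n)\<^esup>\<close> as \<open>n \<rightarrow> \<infinity>\<close>.\<close>
definition has_subexponential_size_sum_ethr_circuits ::
    "(nat \<Rightarrow> bool list \<Rightarrow> bool list \<Rightarrow> bool) \<Rightarrow> bool" where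
  "has_subexponential_size_sum_ethr_circuits g \<longleftrightarrow>
     (\<exists>f :: nat \<Rightarrow> real. f \<in> o(\<lambda>n. real n) \<and>
       (\<forall>\<^sub>F n in sequentially. \<exists>C. sum_ethr_computes n C (g n) \<and>
          real (sum_ethr_size C) \<le> 2 powr f n))"

end

(*
  On inputs x, y an exact threshold gate tests an equality u(x) = v(y), so its truth matrix, of
  side-length N = 2^n, factors through the set of values of u and v with a single nonzero entry
  in each row of either factor. A circuit with s bottom gates therefore gives a factorization
  with at most 2 s N nonzero entries, and s = 2^o(n) makes this N^(1 + o(1)). The two matrices
  are 1 - IP and 1 - 2 IP2 entrywise, where the constant 1 costs one additional trivial gate.
*)
theory Submission
  imports Defs
begin

section \<open>Entries of Kronecker powers\<close>

text \<open>The new factor of each Kronecker product reads the leading digit of the row and column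
  index, and the remaining power reads the lower digits. Rows and columns may have different
  bases.\<close>

lemma kronecker_power_index:
  assumes "i < dim_row A ^ d" "j < dim_col A ^ d"
  shows "kronecker_power A d $$ (i, j) =
    (\<Prod>k<d. (A :: 'a :: comm_semiring_1 mat) $$
      (i div dim_row A ^ k mod dim_row A, j div dim_col A ^ k mod dim_col A))"
  using assms
proof (induction d arbitrary: i j)
  case 0
  then show ?case by simp
next
  case (Suc d)
  let ?r = "dim_row A" and ?c = "dim_col A"
  have pos: "?r > 0" "?c > 0"
    using Suc.prems by (auto intro: Nat.gr0I)
  \<comment> \<open>Removing the leading digit leaves the digits below position \<open>d\<close>
    unchanged.\<close>
  have digit: "a mod r ^ d div r ^ k mod r = a div r ^ k mod r" if "k < d" for a k r :: nat
  proof -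
    define l where "l = d - Suc k"
    have d: "d = k + Suc l"
      using that by (simp add: l_def)
    have "a mod r ^ d div r ^ k = a div r ^ k mod r ^ Suc l"
      unfolding d power_add by (cases "r ^ k = 0") (auto simp: mod_mult2_eq)
    then show ?thesis by (simp add: mod_mod_cancel)
  qed
  \<comment> \<open>The leading quotients are already digits, so the \<open>mod\<close> in the
    factor for \<open>k = d\<close> does not change them.\<close>
  have top: "i div ?r ^ d < ?r" "j div ?c ^ d < ?c"
    using Suc.prems by (simp_all add: less_mult_imp_div_less)
  have "kronecker_power A (Suc d) $$ (i, j) =
      A $$ (i div ?r ^ d, j div ?c ^ d) * kronecker_power A d $$ (i mod ?r ^ d, j mod ?c ^ d)"
    using Suc.prems by (simp add: kronecker_def)
  also have "kronecker_power A d $$ (i mod ?r ^ d, j mod ?c ^ d) =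
      (\<Prod>k<d. A $$ (i div ?r ^ k mod ?r, j div ?c ^ k mod ?c))"
    using pos by (subst Suc.IH) (auto intro!: prod.cong simp: digit)
  finally show ?case
    using top by (simp add: mult.commute)
qed

section \<open>Sparsity and sums of factorizations\<close>

lemma nnz_le_dim_row:
  assumes "\<And>i p. i < dim_row A \<Longrightarrow> p < dim_col A \<Longrightarrow> A $$ (i, p) \<noteq> 0 \<Longrightarrow> p = h i"
  shows "nnz A \<le> dim_row A"
proof -
  have "nnz A \<le> card ((\<lambda>i. (i, h i)) ` {..<dim_row A})"
    unfolding nnz_def using assms by (intro card_mono) auto
  also have "\<dots> \<le> dim_row A"
    using card_image_le[of "{..<dim_row A}"] by simp
  finally show ?thesis .
qed

definition juxtapose :: "'a mat \<Rightarrow> 'a mat \<Rightarrow> 'a mat" where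
  "juxtapose A B = mat (dim_row A) (dim_col A + dim_col B)
     (\<lambda>(i, p). if p < dim_col A then A $$ (i, p) else B $$ (i, p - dim_col A))"

lemma nnz_juxtapose_le:
  assumes "dim_row A = dim_row B"
  shows "nnz (juxtapose A B) \<le> nnz A + nnz B"
proof -
  let ?S = "\<lambda>A. {(i, p). i < dim_row A \<and> p < dim_col A \<and> A $$ (i, p) \<noteq> 0}"
  let ?f = "\<lambda>(i, p). (i, p + dim_col A)"
  have fin: "finite (?S M)" for M :: "'a mat"
    by (rule finite_subset[of _ "{..<dim_row M} \<times> {..<dim_col M}"]) auto
  have "?S (juxtapose A B) \<subseteq> ?S A \<union> ?f ` ?S B"
  proof
    fix q assume q: "q \<in> ?S (juxtapose A B)"
    obtain i p where [simp]: "q = (i, p)" by (cases q)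
    show "q \<in> ?S A \<union> ?f ` ?S B"
    proof (cases "p < dim_col A")
      case True
      then show ?thesis using q by (auto simp: juxtapose_def)
    next
      case False
      then have "(i, p - dim_col A) \<in> ?S B" "q = ?f (i, p - dim_col A)"
        using q assms by (auto simp: juxtapose_def)
      then show ?thesis by blast
    qed
  qed
  then have "nnz (juxtapose A B) \<le> card (?S A \<union> ?f ` ?S B)"
    unfolding nnz_def using fin by (intro card_mono finite_UnI finite_imageI)
  also have "\<dots> \<le> card (?S A) + card (?f ` ?S B)"
    by (rule card_Un_le)
  also have "\<dots> \<le> nnz A + nnz B"
    unfolding nnz_def using fin by (intro add_mono card_image_le order_refl)
  finally show ?thesis .
qed

text \<open>Block multiplication: the product of \<open>[U U']\<close> with the transpose of
  \<open>[V V']\<close> is the sum of the two products, since the inner index runs first over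
  \<open>k\<close> and then over \<open>k'\<close> columns.\<close>

lemma depth2_linear_circuit_add:
  assumes "depth2_linear_circuit M U V" "depth2_linear_circuit M' U' V'"
    and "M' \<in> carrier_mat (dim_row M) (dim_col M)"
  shows "depth2_linear_circuit (M + M') (juxtapose U U') (juxtapose V V')"
proof -
  obtain k where U: "U \<in> carrier_mat (dim_row M) k" and V: "V \<in> carrier_mat (dim_col M) k"
    and M: "M = U * transpose_mat V"
    using assms(1) unfolding depth2_linear_circuit_def by blast
  obtain k' where U': "U' \<in> carrier_mat (dim_row M) k'" and V': "V' \<in> carrier_mat (dim_col M) k'"
    and M': "M' = U' * transpose_mat V'"
    using assms(2) carrier_matD[OF assms(3)] unfolding depth2_linear_circuit_def by metis
  have split: "sum f {0..<k + k'} = sum f {0..<k} + (\<Sum>p = 0..<k'. f (k + p))" for f :: "nat \<Rightarrow> real"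
    by (induction k') (simp_all add: add.assoc)
  have entry: "M $$ (i, j) = (\<Sum>p = 0..<k. U $$ (i, p) * V $$ (j, p))"
    "M' $$ (i, j) = (\<Sum>p = 0..<k'. U' $$ (i, p) * V' $$ (j, p))"
    if "i < dim_row M" "j < dim_col M" for i j
    using that U V U' V' by (subst M M', simp add: scalar_prod_def)+
  have "M + M' = juxtapose U U' * transpose_mat (juxtapose V V')"
  proof (rule eq_matI)
    fix i j
    assume "i < dim_row (juxtapose U U' * transpose_mat (juxtapose V V'))"
      and "j < dim_col (juxtapose U U' * transpose_mat (juxtapose V V'))"
    then have i: "i < dim_row M" and j: "j < dim_col M"
      using U V by (auto simp: juxtapose_def)
    have "(M + M') $$ (i, j) =
        (\<Sum>p = 0..<k. U $$ (i, p) * V $$ (j, p)) + (\<Sum>p = 0..<k'. U' $$ (i, p) * V' $$ (j, p))"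
      using i j U V U' V' assms(3)
      by (simp add: entry)
    also have "\<dots> = (juxtapose U U' * transpose_mat (juxtapose V V')) $$ (i, j)"
      using i j U V U' V' by (simp add: juxtapose_def scalar_prod_def split)
    finally show "(M + M') $$ (i, j) = (juxtapose U U' * transpose_mat (juxtapose V V')) $$ (i, j)" .
  qed (use U V U' V' assms(3) in \<open>auto simp: juxtapose_def\<close>)
  moreover have "juxtapose U U' \<in> carrier_mat (dim_row (M + M')) (k + k')"
      "juxtapose V V' \<in> carrier_mat (dim_col (M + M')) (k + k')"
    using U V U' V' assms(3) by (auto simp: juxtapose_def)
  ultimately show ?thesis
    unfolding depth2_linear_circuit_def by blast
qed

section \<open>Factorizations from threshold gates\<close>

text \<open>The inner index runs over the values of \<open>u\<close> and \<open>v\<close>. Row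
  \<open>i\<close> of \<open>U\<close> marks the value \<open>u i\<close>, and row \<open>j\<close>
  of \<open>V\<close> marks \<open>v j\<close> with weight \<open>c\<close>, so the size does not
  depend on how many values occur.\<close>

lemma depth2_linear_circuit_equality:
  fixes u v :: "nat \<Rightarrow> 'a"
  shows "\<exists>U V. depth2_linear_circuit (mat m n (\<lambda>(i, j). c * of_bool (u i = v j))) U V \<and>
           depth2_linear_circuit_size U V \<le> m + n"
proof -
  define S where "S = u ` {..<m} \<union> v ` {..<n}"
  define k where "k = card S"
  obtain h where h: "bij_betw h S {0..<k}"
    unfolding k_def using ex_bij_betw_finite_nat[of S] by (auto simp: S_def)
  define U :: "real mat" where "U = mat m k (\<lambda>(i, p). of_bool (p = h (u i)))"
  define V where "V = mat n k (\<lambda>(j, p). c * of_bool (p = h (v j)))"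
  have "mat m n (\<lambda>(i, j). c * of_bool (u i = v j)) = U * transpose_mat V"
  proof (rule eq_matI)
    fix i j
    assume "i < dim_row (U * transpose_mat V)" "j < dim_col (U * transpose_mat V)"
    then have i: "i < m" and j: "j < n"
      by (simp_all add: U_def V_def)
    then have S: "u i \<in> S" "v j \<in> S"
      by (auto simp: S_def)
    have "(U * transpose_mat V) $$ (i, j) =
        (\<Sum>p = 0..<k. if p = h (u i) then c * of_bool (p = h (v j)) else 0)"
      using i j by (auto simp: U_def V_def scalar_prod_def intro!: sum.cong)
    \<comment> \<open>As \<open>u i\<close> lies in \<open>S\<close>, the index
      \<open>h (u i)\<close> is below \<open>k\<close>, so exactly this term of the sum
      survives.\<close>
    also have "\<dots> = c * of_bool (h (u i) = h (v j))"
      using h S bij_betwE[OF h] by auto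
    also have "\<dots> = c * of_bool (u i = v j)"
      using inj_on_eq_iff[OF bij_betw_imp_inj_on[OF h]] S by simp
    finally show "mat m n (\<lambda>(i, j). c * of_bool (u i = v j)) $$ (i, j) = (U * transpose_mat V) $$ (i, j)"
      using i j by simp
  qed (simp_all add: U_def V_def)
  moreover have "U \<in> carrier_mat m k" "V \<in> carrier_mat n k"
    by (simp_all add: U_def V_def)
  moreover have "nnz U \<le> m" "nnz V \<le> n"
    using nnz_le_dim_row[of U "\<lambda>i. h (u i)"] nnz_le_dim_row[of V "\<lambda>j. h (v j)"]
    by (auto simp: U_def V_def split: if_splits)
  ultimately show ?thesis
    unfolding depth2_linear_circuit_def depth2_linear_circuit_size_def
    by (metis add_mono dim_row_mat(1) dim_col_mat(1))
qed

text \<open>Moving the terms of \<open>y\<close> across the equation separates the variables: the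
  gate compares a value depending only on \<open>x\<close> with one that depends on \<open>y\<close>
  and on the length of \<open>x\<close>.\<close>

lemma ethr_eval_append:
  "ethr_eval G (x @ y) = of_bool
     ((\<Sum>i<length x. weights G ! i * of_bool (x ! i)) =
      threshold G - (\<Sum>i<length y. weights G ! (length x + i) * of_bool (y ! i)))"
proof -
  have "(\<Sum>i<length x + l. f i) = (\<Sum>i<length x. f i) + (\<Sum>i<l. f (length x + i))"
    for f :: "nat \<Rightarrow> real" and l
    by (induction l) (simp_all add: add.assoc)
  then have "(\<Sum>i<length (x @ y). weights G ! i * of_bool ((x @ y) ! i)) =
      (\<Sum>i<length x. weights G ! i * of_bool (x ! i)) +
      (\<Sum>i<length y. weights G ! (length x + i) * of_bool (y ! i))"
    by (simp add: nth_append)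
  then show ?thesis
    unfolding ethr_eval_def by (auto simp: algebra_simps)
qed

text \<open>Each gate contributes one equality matrix, and juxtaposition adds the sizes. The common
  length \<open>l\<close> makes the weights of \<open>y j\<close> start at the same position for
  every \<open>i\<close>, so that \<open>?v\<close> depends on \<open>j\<close> alone.\<close>

lemma depth2_linear_circuit_sum_ethr:
  fixes x y :: "nat \<Rightarrow> bool list"
  assumes "\<And>i. length (x i) = l"
  shows "\<exists>U V. depth2_linear_circuit (mat m n (\<lambda>(i, j). sum_ethr_eval C (x i @ y j))) U V \<and>
           depth2_linear_circuit_size U V \<le> length C * (m + n)"
proof (induction C)
  case Nil
  \<comment> \<open>The zero matrix factors through inner dimension 0.\<close>
  have "depth2_linear_circuit (mat m n (\<lambda>(i, j). sum_ethr_eval [] (x i @ y j)))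
      (0\<^sub>m m 0) (0\<^sub>m n 0)"
    unfolding depth2_linear_circuit_def
    by (auto intro!: exI[of _ 0] eq_matI simp: sum_ethr_eval_def scalar_prod_def)
  moreover have "depth2_linear_circuit_size (0\<^sub>m m 0) (0\<^sub>m n 0) = 0"
    by (simp add: depth2_linear_circuit_size_def nnz_def)
  ultimately show ?case by force
next
  case (Cons g C)
  obtain c G where g: "g = (c, G)" by (cases g)
  let ?u = "\<lambda>i. \<Sum>k<l. weights G ! k * of_bool (x i ! k)"
  let ?v = "\<lambda>j. threshold G - (\<Sum>k<length (y j). weights G ! (l + k) * of_bool (y j ! k))"
  let ?M = "mat m n (\<lambda>(i, j). c * of_bool (?u i = ?v j))"
  let ?M' = "mat m n (\<lambda>(i, j). sum_ethr_eval C (x i @ y j))"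
  obtain U V where
    UV: "depth2_linear_circuit ?M U V" "depth2_linear_circuit_size U V \<le> m + n"
    using depth2_linear_circuit_equality[of m n c ?u ?v] by blast
  obtain U' V' where
    UV': "depth2_linear_circuit ?M' U' V'" "depth2_linear_circuit_size U' V' \<le> length C * (m + n)"
    using Cons.IH by blast
  have eq: "mat m n (\<lambda>(i, j). sum_ethr_eval (g # C) (x i @ y j)) = ?M + ?M'"
    by (rule eq_matI) (simp_all add: g sum_ethr_eval_def ethr_eval_append assms)
  have "depth2_linear_circuit (?M + ?M') (juxtapose U U') (juxtapose V V')"
    by (rule depth2_linear_circuit_add) (use UV UV' in auto)
  moreover have "dim_row U = dim_row U'" "dim_row V = dim_row V'"
    using UV(1) UV'(1) by (auto simp: depth2_linear_circuit_def)
  then have "depth2_linear_circuit_size (juxtapose U U') (juxtapose V V') \<le> length (g # C) * (m + n)"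
    using UV(2) UV'(2) nnz_juxtapose_le[of U U'] nnz_juxtapose_le[of V V']
    by (simp add: depth2_linear_circuit_size_def)
  ultimately show ?case unfolding eq by blast
qed

section \<open>From subexponential circuits to almost linear factorizations\<close>

text \<open>The least significant bit comes first, matching the digits in
  \<open>kronecker_power_index\<close>.\<close>

definition bits :: "nat \<Rightarrow> nat \<Rightarrow> bool list" where
  "bits d i = map (\<lambda>k. odd (i div 2 ^ k)) [0..<d]"

lemma length_bits [simp]: "length (bits d i) = d"
  by (simp add: bits_def)

lemma nth_bits [simp]: "k < d \<Longrightarrow> bits d i ! k = odd (i div 2 ^ k)"
  by (simp add: bits_def)

lemma almost_linear_if_subexponential:
  assumes M: "\<And>d. M d = mat (2 ^ d) (2 ^ d) (\<lambda>(i, j). a + b * of_bool (g d (bits d i) (bits d j)))"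
    and g: "has_subexponential_size_sum_ethr_circuits g"
  shows "has_almost_linear_size_depth2_circuits M"
proof -
  obtain f where f: "f \<in> o(\<lambda>n. real n)" and
    C: "\<forall>\<^sub>F n in sequentially. \<exists>C. sum_ethr_computes n C (g n) \<and>
          real (sum_ethr_size C) \<le> 2 powr f n"
    using g unfolding has_subexponential_size_sum_ethr_circuits_def by blast
  \<comment> \<open>Chosen so that \<open>d * (1 + e d) = d + f d + 1\<close> for
    \<open>d > 0\<close>; the summand 1 absorbs the factor 2 that comes from having two factors with
    \<open>2 ^ d\<close> rows each.\<close>
  define e where "e d = (f d + 1) / real d" for d
  have "(\<lambda>d. f d / real d + 1 / real d) \<longlonglongrightarrow> 0 + 0"
    using smalloD_tendsto[OF f] lim_1_over_n by (rule tendsto_add)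
  then have "e \<in> o(\<lambda>_. 1)"
    by (intro smalloI_tendsto) (simp_all add: e_def[abs_def] add_divide_distrib)
  moreover have "\<forall>\<^sub>F d in sequentially. \<exists>U V. depth2_linear_circuit (M d) U V \<and>
      real (depth2_linear_circuit_size U V) \<le> (2 ^ d) powr (1 + e d)"
    using C eventually_gt_at_top[of 0]
  proof eventually_elim
    case (elim d)
    then obtain C where C: "sum_ethr_computes d C (g d)" "real (sum_ethr_size C) \<le> 2 powr f d"
      by blast
    \<comment> \<open>The gate with zero weights and zero threshold always outputs 1 and so supplies
      the constant \<open>a\<close>.\<close>
    define C' where "C' = (a, ETHR (replicate (2 * d) 0) 0) # map (\<lambda>(c, G). (b * c, G)) C"
    have "sum_ethr_eval C' z = a + b * sum_ethr_eval C z" if "length z = 2 * d" for z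
      using that
      by (simp add: C'_def sum_ethr_eval_def ethr_eval_def comp_def case_prod_unfold
          sum_list_const_mult[symmetric] mult.assoc)
    then have Md: "M d = mat (2 ^ d) (2 ^ d) (\<lambda>(i, j). sum_ethr_eval C' (bits d i @ bits d j))"
      using C(1) unfolding M by (intro eq_matI) (simp_all add: sum_ethr_computes_def mult_2)
    obtain U V where UV: "depth2_linear_circuit (M d) U V"
        "depth2_linear_circuit_size U V \<le> length C' * (2 ^ d + 2 ^ d)"
      unfolding Md using depth2_linear_circuit_sum_ethr[of "bits d" d] length_bits by metis
    \<comment> \<open>The added constant gate is matched by the top gate, which the size of
      \<open>C\<close> already counts.\<close>
    have "length C' = sum_ethr_size C"
      by (simp add: C'_def sum_ethr_size_def)
    with UV(2) have "depth2_linear_circuit_size U V \<le> sum_ethr_size C * (2 * 2 ^ d)"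
      by (simp only: mult_2)
    then have "real (depth2_linear_circuit_size U V) \<le> real (sum_ethr_size C * (2 * 2 ^ d))"
      by (rule of_nat_mono)
    also have "\<dots> = real (sum_ethr_size C) * (2 * 2 ^ d)"
      by simp
    also have "\<dots> \<le> 2 powr f d * (2 * 2 ^ d)"
      using C(2) by (rule mult_right_mono) simp
    also have "\<dots> = 2 powr (real d * (1 + e d))"
    proof -
      have "real d * (1 + e d) = real d + f d + 1"
        using elim(2) by (simp add: e_def field_simps)
      then show ?thesis by (simp add: powr_add powr_realpow)
    qed
    also have "\<dots> = (2 ^ d) powr (1 + e d)"
      by (simp add: powr_powr[symmetric] powr_realpow)
    finally show ?case
      using UV(1) by blast
  qed
  ultimately show ?thesis
    unfolding has_almost_linear_size_depth2_circuits_def by blast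
qed

section \<open>The two matrices in terms of inner products\<close>

lemma kronecker_power_two_index:
  fixes A :: "'a :: comm_semiring_1 mat"
  assumes "A \<in> carrier_mat 2 2" "i < 2 ^ d" "j < 2 ^ d"
  shows "kronecker_power A d $$ (i, j) =
    (\<Prod>k<d. A $$ (of_bool (bits d i ! k), of_bool (bits d j ! k)))"
  using assms by (subst kronecker_power_index) (auto simp: mod_2_eq_odd intro!: prod.cong)

text \<open>The 2 by 2 matrix vanishes only at \<open>(1, 1)\<close>, so the product over bit
  positions is 0 exactly when some bit is set in both vectors.\<close>

lemma disjointness_matrix_eq:
  "disjointness_matrix d = mat (2 ^ d) (2 ^ d)
     (\<lambda>(i, j). 1 + (- 1) * of_bool (boolean_inner_product d (bits d i) (bits d j)))"
    (is "_ = ?R")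
proof (rule eq_matI)
  let ?A = "mat_of_rows_list 2 [[1, 1], [1, 0]] :: real mat"
  have A: "?A \<in> carrier_mat 2 2"
    by (simp add: mat_of_rows_list_def numeral_2_eq_2)
  have entry: "?A $$ (of_bool p, of_bool q) = (if p \<and> q then 0 else 1)" for p q
    by (cases p; cases q) (simp_all add: mat_of_rows_list_def)
  fix i j
  assume "i < dim_row ?R" "j < dim_col ?R"
  then have ij: "i < 2 ^ d" "j < 2 ^ d" by simp_all
  then have "disjointness_matrix d $$ (i, j) = (\<Prod>k<d. if bits d i ! k \<and> bits d j ! k then 0 else 1)"
    by (simp only: disjointness_matrix_def kronecker_power_two_index[OF A] entry)
  also have "\<dots> = 1 + (- 1) * of_bool (boolean_inner_product d (bits d i) (bits d j))"
    by (auto simp: boolean_inner_product_def simp del: nth_bits intro!: prod.neutral)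
  finally show "disjointness_matrix d $$ (i, j) = ?R $$ (i, j)"
    using ij by simp
qed (simp_all add: disjointness_matrix_def mat_of_rows_list_def numeral_2_eq_2)

text \<open>The 2 by 2 matrix has entries \<open>(- 1) ^ (p * q)\<close>, so the product over bit
  positions is -1 to the power of the integer inner product, of which only the parity
  matters.\<close>

lemma walsh_hadamard_matrix_eq:
  "walsh_hadamard_matrix d = mat (2 ^ d) (2 ^ d)
     (\<lambda>(i, j). 1 + (- 2) * of_bool (boolean_inner_product_mod2 d (bits d i) (bits d j)))"
    (is "_ = ?H")
proof (rule eq_matI)
  let ?A = "mat_of_rows_list 2 [[1, 1], [1, -1]] :: real mat"
  have A: "?A \<in> carrier_mat 2 2"
    by (simp add: mat_of_rows_list_def numeral_2_eq_2)
  have entry: "?A $$ (of_bool p, of_bool q) = (- 1) ^ (of_bool p * of_bool q)" for p q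
    by (cases p; cases q) (simp_all add: mat_of_rows_list_def)
  have sign: "(- 1) ^ s = 1 + (- 2) * (of_bool (s mod 2 = 1) :: real)" for s :: nat
    by (cases "even s") (simp_all add: even_iff_mod_2_eq_zero odd_iff_mod_2_eq_one)
  fix i j
  assume "i < dim_row ?H" "j < dim_col ?H"
  then have ij: "i < 2 ^ d" "j < 2 ^ d" by simp_all
  then have "walsh_hadamard_matrix d $$ (i, j) =
      (\<Prod>k<d. (- 1) ^ (of_bool (bits d i ! k) * of_bool (bits d j ! k)))"
    by (simp only: walsh_hadamard_matrix_def kronecker_power_two_index[OF A] entry)
  also have "\<dots> = 1 + (- 2) * of_bool (boolean_inner_product_mod2 d (bits d i) (bits d j))"
    unfolding power_sum[symmetric] boolean_inner_product_mod2_def by (rule sign)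
  finally show "walsh_hadamard_matrix d $$ (i, j) = ?H $$ (i, j)"
    using ij by simp
qed (simp_all add: walsh_hadamard_matrix_def mat_of_rows_list_def numeral_2_eq_2)

theorem theorem1p6:
  shows "(\<not> has_almost_linear_size_depth2_circuits disjointness_matrix \<longrightarrow>
          \<not> has_subexponential_size_sum_ethr_circuits boolean_inner_product) \<and>
         (\<not> has_almost_linear_size_depth2_circuits walsh_hadamard_matrix \<longrightarrow>
          \<not> has_subexponential_size_sum_ethr_circuits boolean_inner_product_mod2)"
  \<comment> \<open>Both implications are contrapositives, with \<open>a = 1\<close> and
    \<open>b\<close> equal to -1 and -2 respectively.\<close>
  using almost_linear_if_subexponential[OF disjointness_matrix_eq]
    almost_linear_if_subexponential[OF walsh_hadamard_matrix_eq] by blast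

end
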